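(* For the Online Vector Packing Problem with weight vectors in $[0,1]^d$, every (possibly randomized, computationally unbounded) online algorithm has competitive ratio $\Omega(k)$, even when the utility function is $f(S)=|S|$.
   Context: Online Vector Packing Problem: there is a $d$-dimensional knapsack with capacity $1$ in each dimension. Items $u$ arrive online in an arbitrary (adversarial) order; the algorithm does not know the number of items in advance. Each item $u$ has a weight vector $\mathbf{w}_u\in[0,1]^d$, revealed upon arrival. Upon arrival of $u$, the algorithm must immediately decide whether to accept or discard $u$; it may also dispose of previously accepted items at no cost (free disposal), but discarded or disposed-of items can never be recovered. The set $S$ of currently accepted items must always satisfy $\sum_{u\in S}\mathbf{w}_u\le \mathbf{1}$. The utility of a set $S$ is $f(S)$ for a non-negative monotone submodular function $f$. If $S$ is the final set kept, $\mathrm{ALG}=f(S)$, and the competitive ratio is the worst case over instances of $\mathrm{OPT}/\mathbb{E}[\mathrm{ALG}]$, where $\mathrm{OPT}$ is the maximum utility of a feasible subset of all arrived items. The sparsity $k$ is the minimum number such that every weight vector has at most $k$ non-zero coordinates. *)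

theory Defs
  imports "HOL-Probability.Probability"
begin

type_synonym weight = "real list"

text \<open>Items are identified with their arrival positions \<open>0, 1, \<dots>\<close>; an input is the list of
  their weight vectors in order of arrival.\<close>

definition weight_vectors :: "nat \<Rightarrow> weight set" where
  "weight_vectors d = {w. length w = d \<and> (\<forall>i<d. 0 \<le> w ! i \<and> w ! i \<le> 1)}"

definition inputs :: "nat \<Rightarrow> weight list set" where
  "inputs d = lists (weight_vectors d)"

definition sparsity :: "weight list \<Rightarrow> nat" where
  "sparsity ws = (LEAST k. \<forall>w \<in> set ws. card {i. i < length w \<and> w ! i \<noteq> 0} \<le> k)"

definition feasible :: "nat \<Rightarrow> weight list \<Rightarrow> nat set \<Rightarrow> bool" where
  "feasible d ws S \<longleftrightarrow> S \<subseteq> {..<length ws} \<and> (\<forall>i<d. (\<Sum>u\<in>S. ws ! u ! i) \<le> 1)"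

definition utility_function :: "(nat set \<Rightarrow> real) \<Rightarrow> bool" where
  "utility_function f \<longleftrightarrow>
     (\<forall>S. finite S \<longrightarrow> 0 \<le> f S) \<and>
     (\<forall>S T. finite T \<and> S \<subseteq> T \<longrightarrow> f S \<le> f T) \<and>
     (\<forall>S T. finite S \<and> finite T \<longrightarrow> f (S \<union> T) + f (S \<inter> T) \<le> f S + f T)"

lemma utility_function_card: "utility_function (\<lambda>S. real (card S))"
proof -
  have "card (S \<union> T) + card (S \<inter> T) = card S + card T" if "finite S" "finite T" for S T :: "nat set"
    using card_Un_Int[OF that] by simp
  then have "real (card (S \<union> T)) + real (card (S \<inter> T)) \<le> real (card S) + real (card T)"
    if "finite S" "finite T" for S T :: "nat set"
    using that by (metis of_nat_add order_refl)
  then show ?thesis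
    by (auto simp: utility_function_def card_mono)
qed

text \<open>A deterministic algorithm maps the arrivals seen so far to the set of items currently kept.
  It sees neither later arrivals nor the length of the input. When an item arrives, the only
  possible changes are to accept that item and to dispose of items kept so far, so that discarded
  and disposed items never return.\<close>

type_synonym det_algorithm = "weight list \<Rightarrow> nat set"

definition online_algorithm :: "nat \<Rightarrow> det_algorithm \<Rightarrow> bool" where
  "online_algorithm d A \<longleftrightarrow>
     A [] = {} \<and>
     (\<forall>ws w. ws @ [w] \<in> inputs d \<longrightarrow>
        A (ws @ [w]) \<subseteq> insert (length ws) (A ws) \<and> feasible d (ws @ [w]) (A (ws @ [w])))"

text \<open>A randomized algorithm is a probability distribution over deterministic ones: drawing a
  deterministic algorithm amounts to fixing all random choices beforehand. The underlying
  sigma-algebra is arbitrary, as long as the outcome on each input is a random variable.\<close>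

definition randomized_online_algorithm :: "nat \<Rightarrow> det_algorithm measure \<Rightarrow> bool" where
  "randomized_online_algorithm d M \<longleftrightarrow>
     prob_space M \<and>
     (\<forall>A \<in> space M. online_algorithm d A) \<and>
     (\<forall>ws \<in> inputs d. (\<lambda>A. A ws) \<in> M \<rightarrow>\<^sub>M count_space UNIV)"

definition OPT :: "nat \<Rightarrow> (nat set \<Rightarrow> real) \<Rightarrow> weight list \<Rightarrow> real" where
  "OPT d f ws = Max (f ` {S. feasible d ws S})"

definition expected_ALG :: "(nat set \<Rightarrow> real) \<Rightarrow> det_algorithm measure \<Rightarrow> weight list \<Rightarrow> real" where
  "expected_ALG f M ws = (\<integral>A. f (A ws) \<partial>M)"

text \<open>Worst case over the inputs of sparsity \<open>k\<close>. In \<^typ>\<open>ennreal\<close>, the ratio is infinite if the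
  algorithm has expected utility zero and the optimum is positive.\<close>

definition competitive_ratio ::
  "nat \<Rightarrow> nat \<Rightarrow> (nat set \<Rightarrow> real) \<Rightarrow> det_algorithm measure \<Rightarrow> ennreal" where
  "competitive_ratio d k f M =
     (SUP ws \<in> {ws \<in> inputs d. sparsity ws = k}. ennreal (OPT d f ws) / ennreal (expected_ALG f M ws))"

end

theory Submission
  imports Defs
begin

text \<open>
  The adversary releases \<open>n = \<lceil>k / 2\<rceil>\<close> stages of \<open>n\<close> items each, and exactly one item of every
  stage is good. Stage \<open>s\<close> owns two coordinates (stage \<open>0\<close> needs only one); its items are almost
  full there, so at most one item of a stage can be kept. On the coordinates of later stages an
  item has a tiny weight. The weights of the items of one stage are ordered one way on the first
  coordinate of each later stage and in the opposite way on the second, so a bad item is heavier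
  than the good one on one of the two. The scales are nested, stage by stage, around the chosen
  good items so that a bad item outweighs all good items of all stages together. A later stage
  leaves exactly enough room for the good items before it, hence a bad item conflicts with every
  item of every later stage, and a feasible set contains at most one bad item.

  Until the next stage arrives, any item of a stage can still become the good one. The algorithm holds at
  most one of them, so some item is held with probability at most \<open>1 / n\<close>; the adversary makes
  this item the good one. The expected number of kept items is then at most \<open>1 + n / n = 2\<close>, whereas
  the \<open>n\<close> good items together are feasible.
\<close>

section \<open>General facts on online algorithms\<close>

lemma divide_ennreal_mono:
  fixes a b x y :: ennreal
  assumes "a \<le> b" "y \<le> x"
  shows "a / x \<le> b / y"
proof -
  have "inverse x \<le> inverse y"
    using assms(2) including ennreal.lifting by transfer (rule ereal_inverse_antimono)
  then show ?thesis
    unfolding divide_ennreal_def using assms(1) by (intro mult_mono) auto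
qed

lemma online_algorithm_subset:
  assumes "online_algorithm d A" "ws \<in> inputs d"
  shows "A ws \<subseteq> {..<length ws}"
proof (cases ws rule: rev_cases)
  case Nil
  then show ?thesis using assms by (simp add: online_algorithm_def)
next
  case (snoc vs v)
  then show ?thesis using assms by (auto simp: online_algorithm_def feasible_def)
qed

lemma online_algorithm_feasible:
  assumes "online_algorithm d A" "ws \<in> inputs d"
  shows "feasible d ws (A ws)"
proof (cases ws rule: rev_cases)
  case Nil
  then show ?thesis using assms by (simp add: online_algorithm_def feasible_def)
next
  case (snoc vs v)
  then show ?thesis using assms by (auto simp: online_algorithm_def)
qed

text \<open>Each later arrival can add only itself, and its position lies beyond
  \<open>ws\<close>.\<close>

lemma online_algorithm_prefix:
  assumes "online_algorithm d A" "ws @ vs \<in> inputs d"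
  shows "A (ws @ vs) \<inter> {..<length ws} \<subseteq> A ws"
  using assms(2)
proof (induction vs rule: rev_induct)
  case (snoc v vs)
  have "ws @ vs \<in> inputs d"
    using snoc.prems by (simp add: inputs_def)
  moreover have "A ((ws @ vs) @ [v]) \<subseteq> insert (length (ws @ vs)) (A (ws @ vs))"
    using assms(1) snoc.prems unfolding online_algorithm_def by (metis append_assoc)
  ultimately show ?case using snoc.IH by auto
qed simp

lemma card_le_OPT:
  assumes "feasible d ws S"
  shows "real (card S) \<le> OPT d (\<lambda>S. real (card S)) ws"
proof -
  have "finite {S. feasible d ws S}"
    by (rule finite_subset[of _ "Pow {..<length ws}"]) (auto simp: feasible_def)
  then show ?thesis unfolding OPT_def using assms by (auto intro!: Max_ge)
qed

locale hard_instance =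
  fixes k d :: nat
  assumes k_pos: "0 < k" and k_le_d: "k \<le> d"
begin

section \<open>Construction of the hard instance\<close>

definition n :: nat where "n = (k + 1) div 2"

definition digit :: "bool \<Rightarrow> nat \<Rightarrow> nat" where
  "digit b a = (if b then a else n - 1 - a)"

text \<open>A list \<open>gs\<close> records the good items of the stages before \<open>length gs\<close>, and \<open>gs @ [a]\<close> stands for item
  \<open>a\<close> of that stage. Reading digits in base \<open>n\<close>, such a list owns the interval from \<open>lower\<close> to
  \<open>upper\<close> inside \<open>[0, n ^ n]\<close>; extensions own subintervals and siblings disjoint ones. The flag
  selects one of the two opposite orders of siblings.\<close>

definition val :: "bool \<Rightarrow> nat list \<Rightarrow> nat" where
  "val b hs = foldl (\<lambda>v a. v * n + digit b a) 0 hs"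

definition lower :: "bool \<Rightarrow> nat list \<Rightarrow> nat" where
  "lower b hs = val b hs * n ^ (n - length hs)"

definition upper :: "bool \<Rightarrow> nat list \<Rightarrow> nat" where
  "upper b hs = (val b hs + 1) * n ^ (n - length hs)"

text \<open>An interval that ends earlier gives a heavier weight. Its end is smaller by at least 1,
  so its level is larger by a factor of at least \<open>2 * n + 1\<close>. Hence \<open>n\<close>
  levels of later ends cannot add up to it, and any \<open>n\<close> levels stay below 1/2 in
  total.\<close>

definition level :: "bool \<Rightarrow> nat list \<Rightarrow> real" where
  "level b hs = (1 / (2 * real n + 1)) ^ upper b hs"

text \<open>The total weight of the good items before stage \<open>length gs\<close> on the
  coordinate of order \<open>b\<close> that this stage owns.\<close>

definition load :: "bool \<Rightarrow> nat list \<Rightarrow> real" where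
  "load b gs = (\<Sum>r<length gs. level b (take (Suc r) gs))"

text \<open>Stage \<open>s\<close> owns the coordinates \<open>i\<close> with \<open>(i + 1) div 2 = s\<close>, that is \<open>2 * s - 1\<close> and \<open>2 * s\<close>, and the
  parity of \<open>i\<close> selects the order.\<close>

definition weight :: "nat list \<Rightarrow> nat \<Rightarrow> nat \<Rightarrow> real" where
  "weight gs a i =
     (if k \<le> i \<or> (i + 1) div 2 < length gs then 0
      else if (i + 1) div 2 = length gs then 1 - load (odd i) gs
      else level (odd i) (gs @ [a]))"

definition item :: "nat list \<Rightarrow> nat \<Rightarrow> weight" where
  "item gs a = map (weight gs a) [0..<d]"

text \<open>The last entry of \<open>gs\<close> does not influence \<open>run gs\<close>, so the adversary may choose it after
  observing the algorithm on \<open>run gs\<close>.\<close>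

definition run :: "nat list \<Rightarrow> weight list" where
  "run gs = concat (map (\<lambda>s. map (item (take s gs)) [0..<n]) [0..<length gs])"

section \<open>Nested intervals\<close>

lemma n_pos: "0 < n"
  using k_pos by (auto simp: n_def)

lemma digit_less: "a < n \<Longrightarrow> digit b a < n"
  by (auto simp: digit_def)

lemma nth_path_less: "set gs \<subseteq> {..<n} \<Longrightarrow> s < length gs \<Longrightarrow> gs ! s < n"
  using nth_mem by blast

lemma val_snoc: "val b (hs @ [a]) = val b hs * n + digit b a"
  by (simp add: val_def)

lemma lower_less_upper: "lower b hs < upper b hs"
  using n_pos by (simp add: lower_def upper_def)

lemma power_step: "s < n \<Longrightarrow> n ^ (n - s) = n * n ^ (n - Suc s)"
  by (metis Suc_diff_Suc power_Suc)

lemma lower_le_snoc: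
  assumes "length hs < n"
  shows "lower b hs \<le> lower b (hs @ [a])"
  using power_step[OF assms] by (simp add: lower_def val_snoc algebra_simps)

lemma upper_snoc_le:
  assumes "length hs < n" "a < n"
  shows "upper b (hs @ [a]) \<le> upper b hs"
proof -
  have "val b hs * n + digit b a + 1 \<le> (val b hs + 1) * n"
    using digit_less[OF assms(2), of b] by (simp add: algebra_simps)
  then have "(val b hs * n + digit b a + 1) * n ^ (n - Suc (length hs))
      \<le> (val b hs + 1) * n * n ^ (n - Suc (length hs))"
    by (rule mult_right_mono) simp
  then show ?thesis
    unfolding upper_def by (simp add: power_step[OF assms(1)] val_snoc mult.assoc del: mult_Suc)
qed

lemma upper_le_lower_sibling:
  assumes "digit b a < digit b a'"
  shows "upper b (hs @ [a]) \<le> lower b (hs @ [a'])"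
  using assms by (auto simp: upper_def lower_def val_snoc simp del: add_Suc_right intro!: mult_right_mono)

lemma lower_take_mono:
  assumes "r \<le> s" "s \<le> length gs" "length gs \<le> n"
  shows "lower b (take r gs) \<le> lower b (take s gs)"
  using assms
proof (induction s rule: dec_induct)
  case (step m)
  have "lower b (take m gs) \<le> lower b (take m gs @ [gs ! m])"
    using step by (intro lower_le_snoc) auto
  then show ?case using step by (simp add: take_Suc_conv_app_nth)
qed simp

lemma upper_take_antimono:
  assumes "r \<le> s" "s \<le> length gs" "length gs \<le> n" "set gs \<subseteq> {..<n}"
  shows "upper b (take s gs) \<le> upper b (take r gs)"
  using assms
proof (induction s rule: dec_induct)
  case (step m)
  have "upper b (take m gs @ [gs ! m]) \<le> upper b (take m gs)"
    using step by (intro upper_snoc_le) (auto simp: nth_path_less)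
  then show ?case using step by (simp add: take_Suc_conv_app_nth)
qed simp

text \<open>The interval of the bad item \<open>a\<close> ends no later than that of its good
  sibling begins. The prefixes of \<open>gs\<close> own nested intervals, so each of them lies
  inside the sibling's interval or contains it, and in both cases ends after that beginning.\<close>

lemma upper_wrong_less:
  assumes "s < length gs" "r < length gs" "length gs \<le> n" "set gs \<subseteq> {..<n}"
    and "digit b a < digit b (gs ! s)"
  shows "upper b (take s gs @ [a]) < upper b (take (Suc r) gs)"
proof -
  have "upper b (take s gs @ [a]) \<le> lower b (take (Suc s) gs)"
    using upper_le_lower_sibling[OF assms(5)] assms(1) by (simp add: take_Suc_conv_app_nth)
  also have "\<dots> < upper b (take (Suc r) gs)"
  proof (cases "s \<le> r")
    case True
    then have "lower b (take (Suc s) gs) \<le> lower b (take (Suc r) gs)"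
      using assms by (intro lower_take_mono) auto
    then show ?thesis using lower_less_upper by (rule le_less_trans)
  next
    case False
    then have "upper b (take (Suc s) gs) \<le> upper b (take (Suc r) gs)"
      using assms by (intro upper_take_antimono) auto
    with lower_less_upper show ?thesis by (rule less_le_trans)
  qed
  finally show ?thesis .
qed

section \<open>Levels, loads and weights\<close>

lemma level_pos: "0 < level b hs"
  by (simp add: level_def add_nonneg_pos)

lemma level_le_of_upper_less:
  assumes "upper b hs < upper b' hs'"
  shows "level b' hs' \<le> level b hs / (2 * real n + 1)"
proof -
  have "level b' hs' \<le> (1 / (2 * real n + 1)) ^ Suc (upper b hs)"
    unfolding level_def using assms by (intro power_decreasing) auto
  then show ?thesis by (simp add: level_def)
qed

lemma level_le: "level b hs \<le> 1 / (2 * real n + 1)"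
proof -
  have "0 < upper b hs" using lower_less_upper[of b hs] by simp
  then have "level b hs \<le> (1 / (2 * real n + 1)) ^ 1"
    unfolding level_def by (intro power_decreasing) auto
  then show ?thesis by simp
qed

lemma load_nonneg: "0 \<le> load b gs"
  unfolding load_def using level_pos by (intro sum_nonneg) (auto intro: less_imp_le)

lemma load_less_half:
  assumes "length gs \<le> n"
  shows "load b gs < 1 / 2"
proof -
  have "load b gs \<le> real (length gs) * (1 / (2 * real n + 1))"
    unfolding load_def using sum_bounded_above[of "{..<length gs}" _ "1 / (2 * real n + 1)"] level_le
    by simp
  also have "\<dots> \<le> real n * (1 / (2 * real n + 1))"
    using assms by (intro mult_right_mono) auto
  also have "\<dots> < 1 / 2" by (simp add: field_simps)
  finally show ?thesis .
qed

text \<open>All summands of the load have later ends than the bad item, so each is at most a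
  fraction \<open>1 / (2 * n + 1)\<close> of its level, and there are at most \<open>n\<close> of
  them.\<close>

lemma load_take_less_level:
  assumes "s < length gs" "length gs \<le> n" "set gs \<subseteq> {..<n}" "t \<le> length gs"
    and "digit b a < digit b (gs ! s)"
  shows "load b (take t gs) < level b (take s gs @ [a])"
proof -
  let ?l = "level b (take s gs @ [a])"
  have "level b (take (Suc r) (take t gs)) \<le> ?l / (2 * real n + 1)" if "r < t" for r
  proof -
    have "upper b (take s gs @ [a]) < upper b (take (Suc r) gs)"
      using assms that by (intro upper_wrong_less) auto
    then show ?thesis using level_le_of_upper_less that by (simp add: min_absorb1)
  qed
  then have "load b (take t gs) \<le> real t * (?l / (2 * real n + 1))"
    unfolding load_def using assms(4) sum_bounded_above[of "{..<t}" _ "?l / (2 * real n + 1)"]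
    by (simp add: min_absorb2)
  also have "\<dots> \<le> real n * (?l / (2 * real n + 1))"
    using assms level_pos[of b "take s gs @ [a]"] by (intro mult_right_mono) auto
  also have "\<dots> < ?l"
    using level_pos[of b "take s gs @ [a]"] by (simp add: field_simps add_strict_increasing)
  finally show ?thesis .
qed

lemma weight_bounds:
  assumes "length gs \<le> n"
  shows "0 \<le> weight gs a i \<and> weight gs a i \<le> 1"
proof -
  have "level (odd i) (gs @ [a]) \<le> 1"
    using level_le[of "odd i" "gs @ [a]"] by (rule order_trans) simp
  then show ?thesis
    using load_less_half[OF assms, of "odd i"] load_nonneg[of "odd i" gs]
      level_pos[of "odd i" "gs @ [a]"]
    unfolding weight_def by auto
qed

text \<open>This makes any two items of one stage conflict. The even coordinate is chosen because
  stage 0 owns no odd one.\<close>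

lemma weight_gt_half:
  assumes "length gs < n"
  shows "1 / 2 < weight gs a (2 * length gs)"
proof -
  have "2 * length gs < k" using assms unfolding n_def by linarith
  then show ?thesis using load_less_half[of gs False] assms by (simp add: weight_def)
qed

section \<open>The released input and its sparsity\<close>

lemma item_nth: "i < d \<Longrightarrow> item gs a ! i = weight gs a i"
  by (simp add: item_def)

lemma run_snoc: "run (gs @ [a]) = run gs @ map (item gs) [0..<n]"
  by (auto simp: run_def intro!: arg_cong[of _ _ concat] map_cong)

lemma length_run: "length (run gs) = length gs * n"
proof (induction gs rule: rev_induct)
  case Nil
  show ?case by (simp add: run_def)
qed (simp add: run_snoc)

lemma run_nth:
  assumes "s < length gs" "a < n"
  shows "run gs ! (s * n + a) = item (take s gs) a"
  using assms(1)
proof (induction gs rule: rev_induct)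
  case (snoc x gs)
  show ?case
  proof (cases "s < length gs")
    case True
    then have "(s + 1) * n \<le> length gs * n" by (intro mult_right_mono) auto
    then have "s * n + a < length (run gs)" using assms(2) by (simp add: length_run)
    then show ?thesis using snoc.IH[OF True] True by (simp add: run_snoc nth_append)
  next
    case False
    then have "s = length gs" using snoc.prems by simp
    then show ?thesis using assms(2) by (simp add: run_snoc nth_append length_run)
  qed
qed simp

lemma set_run:
  "set (run gs) = (\<Union>s<length gs. item (take s gs) ` {..<n})"
  by (auto simp: run_def)

lemma run_append: "\<exists>vs. run (gs @ hs) = run gs @ vs"
proof (induction hs rule: rev_induct)
  case (snoc h hs)
  then show ?case using run_snoc[of "gs @ hs" h] by auto
qed simp

lemma run_in_inputs:
  assumes "length gs \<le> n"
  shows "run gs \<in> inputs d"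
proof -
  have "item (take s gs) a \<in> weight_vectors d" for s a
    using weight_bounds[of "take s gs" a] assms
    by (auto simp: weight_vectors_def item_nth) (simp add: item_def)
  then show ?thesis by (auto simp: inputs_def set_run lists_eq_set)
qed

lemma sparsity_run:
  assumes "0 < length gs" "length gs \<le> n"
  shows "sparsity (run gs) = k"
  unfolding sparsity_def
proof (rule Least_equality)
  show "\<forall>w\<in>set (run gs). card {i. i < length w \<and> w ! i \<noteq> 0} \<le> k"
  proof
    fix w assume "w \<in> set (run gs)"
    then obtain s a where w: "w = item (take s gs) a" by (auto simp: set_run)
    have "{i. i < length w \<and> w ! i \<noteq> 0} \<subseteq> {..<k}"
      unfolding w by (auto simp: item_def weight_def split: if_splits)
    then show "card {i. i < length w \<and> w ! i \<noteq> 0} \<le> k"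
      using card_mono[of "{..<k}"] by fastforce
  qed
next
  fix j assume j: "\<forall>w\<in>set (run gs). card {i. i < length w \<and> w ! i \<noteq> 0} \<le> j"
  \<comment> \<open>Items of stage 0 attain the sparsity: no coordinate belongs to an earlier stage,
    so all of the first \<open>k\<close> entries are positive.\<close>
  let ?w = "item [] 0"
  have "?w \<in> set (run gs)" using assms n_pos by (force simp: set_run)
  then have "card {i. i < length ?w \<and> ?w ! i \<noteq> 0} \<le> j" using j by blast
  moreover have "{i. i < length ?w \<and> ?w ! i \<noteq> 0} = {..<k}"
  proof -
    have "?w ! i \<noteq> 0 \<longleftrightarrow> i < k" if "i < d" for i
      using that level_pos[of "odd i" "[0]"] by (auto simp: item_nth weight_def load_def)
    moreover have "length ?w = d" by (simp add: item_def)
    ultimately show ?thesis using k_le_d by (intro set_eqI) (simp, meson less_le_trans)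
  qed
  ultimately show "k \<le> j" by simp
qed

section \<open>The good items are feasible together\<close>

definition good :: "nat list \<Rightarrow> nat \<Rightarrow> nat" where
  "good gs s = s * n + gs ! s"

lemma good_div:
  assumes "gs ! s < n"
  shows "good gs s div n = s"
  using assms n_pos by (auto simp: good_def)

text \<open>On a coordinate owned by stage \<open>?o\<close>, the earlier good items weigh exactly
  the load, the good item of stage \<open>?o\<close> fills the rest, and later items weigh
  nothing.\<close>

lemma good_weights_le:
  assumes "length gs = n" "i < d"
  shows "(\<Sum>s<n. weight (take s gs) (gs ! s) i) \<le> 1"
proof (cases "k \<le> i")
  case True
  then show ?thesis by (simp add: weight_def)
next
  case False
  let ?o = "(i + 1) div 2"
  have eq: "weight (take s gs) (gs ! s) i = (if s < ?o then level (odd i) (take (Suc s) gs)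
      else if s = ?o then 1 - load (odd i) (take s gs) else 0)" if "s < n" for s
    using that assms False by (auto simp: weight_def take_Suc_conv_app_nth)
  show ?thesis
  proof (cases "?o < n")
    case True
    have "(\<Sum>s<n. weight (take s gs) (gs ! s) i) = (\<Sum>s<Suc ?o. weight (take s gs) (gs ! s) i)"
      using True eq by (intro sum.mono_neutral_right) auto
    also have "\<dots> = (\<Sum>s<?o. level (odd i) (take (Suc s) gs)) + (1 - load (odd i) (take ?o gs))"
      using True by (simp add: eq del: One_nat_def)
    also have "(\<Sum>s<?o. level (odd i) (take (Suc s) gs)) = load (odd i) (take ?o gs)"
      using True assms by (auto simp: load_def min_absorb1 min_absorb2 intro!: sum.cong)
    finally show ?thesis by simp
  next
    \<comment> \<open>For even \<open>k\<close>, the coordinate \<open>k - 1\<close> belongs to no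
      stage; the good items have only their levels there.\<close>
    case o: False
    have "(\<Sum>s<n. weight (take s gs) (gs ! s) i) = load (odd i) gs"
      unfolding load_def using o assms by (intro sum.cong) (auto simp: eq)
    then show ?thesis using load_less_half[of gs "odd i"] assms by simp
  qed
qed

lemma OPT_run_ge:
  assumes "length gs = n" "set gs \<subseteq> {..<n}"
  shows "real n \<le> OPT d (\<lambda>S. real (card S)) (run gs)"
proof -
  have gs: "gs ! s < n" if "s < n" for s
    using assms that by (simp add: nth_path_less)
  have inj: "inj_on (good gs) {..<n}"
    by (rule inj_on_inverseI[where g = "\<lambda>u. u div n"]) (simp add: gs good_div)
  have "feasible d (run gs) (good gs ` {..<n})"
    unfolding feasible_def
  proof (intro conjI allI impI)
    show "good gs ` {..<n} \<subseteq> {..<length (run gs)}"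
    proof
      fix u assume "u \<in> good gs ` {..<n}"
      then obtain s where s: "s < n" "u = good gs s" by auto
      then have "(s + 1) * n \<le> n * n" by (intro mult_right_mono) auto
      then show "u \<in> {..<length (run gs)}"
        using gs[OF s(1)] s assms by (simp add: good_def length_run)
    qed
    fix i assume i: "i < d"
    have "(\<Sum>u\<in>good gs ` {..<n}. run gs ! u ! i) = (\<Sum>s<n. weight (take s gs) (gs ! s) i)"
      unfolding sum.reindex[OF inj] using assms gs i
      by (intro sum.cong) (auto simp: good_def run_nth item_nth)
    then show "(\<Sum>u\<in>good gs ` {..<n}. run gs ! u ! i) \<le> 1"
      using good_weights_le[OF assms(1) i] by simp
  qed
  from card_le_OPT[OF this] show ?thesis by (simp add: card_image inj)
qed

section \<open>Conflicts and the number of items kept\<close>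

lemma wrong_items_conflict:
  assumes gs: "length gs = n" "set gs \<subseteq> {..<n}"
    and st: "s \<le> t" "t < n" and a: "a < n" "a \<noteq> gs ! s"
  shows "\<exists>i<d. weight (take s gs) a i + weight (take t gs) a' i > 1"
proof (cases "s = t")
  case True
  have "2 * t < d" using st k_le_d unfolding n_def by linarith
  then show ?thesis
    using weight_gt_half[of "take t gs" a] weight_gt_half[of "take t gs" a'] True st gs
    by (intro exI[of _ "2 * t"]) (simp add: min_absorb2)
next
  case False
  have gss: "gs ! s < n" using gs st by (simp add: nth_path_less)
  \<comment> \<open>The smaller digit is the heavier item, so \<open>b\<close> picks the order in
    which \<open>a\<close> outweighs the good item of its stage. The level of \<open>a\<close> then
    exceeds the room, equal to the load, that an item of stage \<open>t\<close> leaves on its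
    coordinate of this order.\<close>
  define b where "b \<longleftrightarrow> a < gs ! s"
  have dig: "digit b a < digit b (gs ! s)"
    using a gss by (auto simp: digit_def b_def)
  define i where "i = (if b then 2 * t - 1 else 2 * t)"
  have "2 * t < k" using st unfolding n_def by linarith
  then have i: "i < k" "(i + 1) div 2 = t" "odd i = b"
    using False st by (auto simp: i_def)
  have "load b (take t gs) < level b (take s gs @ [a])"
    using gs st dig by (intro load_take_less_level) auto
  then show ?thesis
    using i False st gs k_le_d by (intro exI[of _ i]) (simp add: weight_def)
qed

text \<open>At most one bad item is kept, since two bad ones conflict. A good item in the final set
  was already held at the end of its own stage, because disposed items never return.\<close>

lemma card_algorithm_le:
  assumes A: "online_algorithm d A" and gs: "length gs = n" "set gs \<subseteq> {..<n}"
  shows "card (A (run gs)) \<le> 1 + card {s. s < n \<and> good gs s \<in> A (run (take (Suc s) gs))}"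
proof -
  let ?S = "A (run gs)"
  let ?G = "{s. s < n \<and> good gs s \<in> A (run (take (Suc s) gs))}"
  let ?B = "{u \<in> ?S. u mod n \<noteq> gs ! (u div n)}"
  have inp: "run gs \<in> inputs d" using gs by (simp add: run_in_inputs)
  have S: "?S \<subseteq> {..<n * n}"
    using online_algorithm_subset[OF A inp] gs by (simp add: length_run)
  have fin: "finite ?S" using S finite_subset by blast
  have div: "u div n < n" if "u \<in> ?S" for u
    using S that by (auto simp: less_mult_imp_div_less)
  have nth: "run gs ! u ! i = weight (take (u div n) gs) (u mod n) i" if "u \<in> ?S" "i < d" for u i
    using run_nth[of "u div n" gs "u mod n"] div[OF that(1)] n_pos gs that by (simp add: item_nth)
  have feas: "(\<Sum>u\<in>?S. run gs ! u ! i) \<le> 1" if "i < d" for i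
    using online_algorithm_feasible[OF A inp] that by (simp add: feasible_def)
  \<comment> \<open>The conflict needs a bad item in the stage that is not later, so the pair is
    ordered by stage first.\<close>
  have le: "u = v" if "u \<in> ?B" "v \<in> ?B" "u div n \<le> v div n" for u v
  proof (rule ccontr)
    assume "u \<noteq> v"
    from wrong_items_conflict[OF gs that(3) div, of "u mod n" "v mod n"] that n_pos
    obtain i where i: "i < d"
      "weight (take (u div n) gs) (u mod n) i + weight (take (v div n) gs) (v mod n) i > 1"
      by auto
    have "(\<Sum>w\<in>{u, v}. run gs ! w ! i) \<le> (\<Sum>w\<in>?S. run gs ! w ! i)"
      using that fin i gs weight_bounds by (intro sum_mono2) (auto simp: nth)
    with feas[OF i(1)] i that \<open>u \<noteq> v\<close> show False by (simp add: nth)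
  qed
  have "u = v" if "u \<in> ?B" "v \<in> ?B" for u v
    using le[OF that] le[OF that(2,1)] nat_le_linear[of "u div n" "v div n"] by blast
  moreover have "finite ?B" using fin by simp
  ultimately have "card ?B \<le> 1" by (metis (no_types, lifting) One_nat_def card_le_Suc0_iff_eq)
  have "?S - ?B \<subseteq> good gs ` ?G"
  proof
    fix u assume u: "u \<in> ?S - ?B"
    define s where "s = u div n"
    have s: "s < n" using div u by (auto simp: s_def)
    have us: "u = good gs s"
      using u by (auto simp: good_def s_def) (metis div_mult_mod_eq)
    have "gs ! s < n" using gs s by (simp add: nth_path_less)
    obtain vs where vs: "run gs = run (take (Suc s) gs) @ vs"
      using run_append[of "take (Suc s) gs" "drop (Suc s) gs"] by auto
    have "u < length (run (take (Suc s) gs))"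
      using s gs \<open>gs ! s < n\<close> us by (simp add: length_run good_def min_absorb2)
    then have "u \<in> A (run (take (Suc s) gs))"
      using online_algorithm_prefix[OF A inp[unfolded vs]] u vs by auto
    then show "u \<in> good gs ` ?G" using us s by auto
  qed
  then have "card (?S - ?B) \<le> card ?G"
    using surj_card_le[of ?G "?S - ?B" "good gs"] by simp
  moreover have "card ?S \<le> card (?S - ?B) + card ?B"
    using fin card_Un_le[of "?S - ?B" ?B] by (simp add: Un_absorb2 Collect_restrict)
  ultimately show ?thesis using \<open>card ?B \<le> 1\<close> by linarith
qed

lemma at_most_one_of_last_stage:
  assumes A: "online_algorithm d A" and gs: "length gs < n" and ab: "a < n" "b < n"
    and mem: "length gs * n + a \<in> A (run (gs @ [x]))" "length gs * n + b \<in> A (run (gs @ [x]))"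
  shows "a = b"
proof (rule ccontr)
  assume "a \<noteq> b"
  let ?ws = "run (gs @ [x])" and ?i = "2 * length gs"
  let ?u = "\<lambda>a. length gs * n + a"
  have inp: "?ws \<in> inputs d" using gs by (simp add: run_in_inputs)
  have i: "?i < d" using gs k_le_d unfolding n_def by linarith
  have nth: "?ws ! ?u c ! ?i > 1 / 2" if "c < n" for c
    using run_nth[of "length gs" "gs @ [x]" c] weight_gt_half[OF gs, of c] that i
    by (simp add: item_nth)
  have fin: "finite (A ?ws)"
    using online_algorithm_subset[OF A inp] finite_subset by blast
  have nonneg: "0 \<le> ?ws ! v ! ?i" if "v \<in> A ?ws" for v
  proof -
    have "v < length ?ws" using online_algorithm_subset[OF A inp] that by auto
    then have "?ws ! v \<in> weight_vectors d"
      using inp nth_mem[of v ?ws] by (auto simp: inputs_def)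
    then show ?thesis using i by (simp add: weight_vectors_def)
  qed
  have "(\<Sum>v\<in>{?u a, ?u b}. ?ws ! v ! ?i) \<le> (\<Sum>v\<in>A ?ws. ?ws ! v ! ?i)"
    using mem fin nonneg by (intro sum_mono2) auto
  also have "\<dots> \<le> 1"
    using online_algorithm_feasible[OF A inp] i by (simp add: feasible_def)
  finally show False using nth[OF ab(1)] nth[OF ab(2)] \<open>a \<noteq> b\<close> by simp
qed

section \<open>The adversary against a randomized algorithm\<close>

text \<open>Observing the algorithm at the end of stage \<open>s\<close> makes the event depend only
  on the first \<open>Suc s\<close> entries of \<open>gs\<close>, so the good items can be chosen
  stage by stage.\<close>

definition caught :: "det_algorithm measure \<Rightarrow> nat list \<Rightarrow> nat \<Rightarrow> det_algorithm set" where
  "caught M gs s = {A \<in> space M. good gs s \<in> A (run (take (Suc s) gs))}"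

lemma caught_sets:
  assumes "randomized_online_algorithm d M" "length gs \<le> n"
  shows "caught M gs s \<in> sets M"
proof -
  have "(\<lambda>A. A (run (take (Suc s) gs))) \<in> M \<rightarrow>\<^sub>M count_space UNIV"
    using assms run_in_inputs[of "take (Suc s) gs"] by (simp add: randomized_online_algorithm_def)
  from measurable_sets[OF this, of "{S. good gs s \<in> S}"] show ?thesis
    by (simp add: caught_def vimage_def Int_def conj_commute)
qed

text \<open>By induction on the stages: the \<open>n\<close> candidates of the new stage give
  disjoint events, so one has probability at most \<open>1 / n\<close>, and appending it leaves the
  earlier events unchanged.\<close>

lemma exists_unlikely_path:
  assumes M: "randomized_online_algorithm d M" and "m \<le> n"
  shows "\<exists>gs. length gs = m \<and> set gs \<subseteq> {..<n} \<and> (\<forall>s<m. measure M (caught M gs s) \<le> 1 / real n)"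
  using assms(2)
proof (induction m)
  case (Suc m)
  interpret prob_space M using M by (simp add: randomized_online_algorithm_def)
  obtain gs where gs: "length gs = m" "set gs \<subseteq> {..<n}" "\<forall>s<m. prob (caught M gs s) \<le> 1 / real n"
    using Suc by auto
  let ?E = "\<lambda>a. caught M (gs @ [a]) m"
  \<comment> \<open>The entry 0 is a placeholder: \<open>run\<close> ignores the last entry, so all
    candidates are compared on the same input.\<close>
  have E: "?E a = {A \<in> space M. m * n + a \<in> A (run (gs @ [0]))}" for a
    using gs by (simp add: caught_def good_def nth_append run_snoc)
  have sets: "?E a \<in> events" for a
    using M gs Suc.prems by (intro caught_sets) auto
  have "disjoint_family_on ?E {..<n}"
    unfolding disjoint_family_on_def
  proof (intro ballI impI)
    fix a b assume ab: "a \<in> {..<n}" "b \<in> {..<n}" "a \<noteq> b"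
    have False if "A \<in> ?E a" "A \<in> ?E b" for A
    proof -
      have "online_algorithm d A"
        using M that by (simp add: E randomized_online_algorithm_def)
      from at_most_one_of_last_stage[OF this, of gs a b 0] show False
        using that ab gs Suc.prems by (simp add: E)
    qed
    then show "?E a \<inter> ?E b = {}" by blast
  qed
  then have "(\<Sum>a<n. prob (?E a)) = prob (\<Union>a<n. ?E a)"
    using sets by (intro finite_measure_finite_Union[symmetric]) auto
  also have "\<dots> \<le> 1" by (rule prob_le_1)
  finally have sum: "(\<Sum>a<n. prob (?E a)) \<le> 1" .
  have "\<exists>a<n. prob (?E a) \<le> 1 / real n"
  proof (rule ccontr)
    assume "\<not> (\<exists>a<n. prob (?E a) \<le> 1 / real n)"
    then have "(\<Sum>a<n. 1 / real n) < (\<Sum>a<n. prob (?E a))"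
      using n_pos by (intro sum_strict_mono) (auto simp: not_le)
    then show False using sum n_pos by simp
  qed
  then obtain a where a: "a < n" "prob (?E a) \<le> 1 / real n" by auto
  have "caught M (gs @ [a]) s = caught M gs s" if "s < m" for s
    using that gs by (simp add: caught_def good_def nth_append)
  then show ?case using gs a by (intro exI[of _ "gs @ [a]"]) (auto simp: less_Suc_eq)
qed simp

text \<open>Taking expectations in \<open>card_algorithm_le\<close> bounds the value by 1 plus
  \<open>n\<close> probabilities of at most \<open>1 / n\<close>.\<close>

lemma expected_ALG_le_2:
  assumes M: "randomized_online_algorithm d M" and gs: "length gs = n" "set gs \<subseteq> {..<n}"
    and unlikely: "\<And>s. s < n \<Longrightarrow> measure M (caught M gs s) \<le> 1 / real n"
  shows "expected_ALG (\<lambda>S. real (card S)) M (run gs) \<le> 2"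
proof -
  interpret prob_space M using M by (simp add: randomized_online_algorithm_def)
  have inp: "run gs \<in> inputs d" using gs by (simp add: run_in_inputs)
  have sets: "caught M gs s \<in> events" for s
    using M gs by (intro caught_sets) auto
  have online: "online_algorithm d A" if "A \<in> space M" for A
    using M that by (simp add: randomized_online_algorithm_def)
  have meas: "(\<lambda>A. A (run gs)) \<in> M \<rightarrow>\<^sub>M count_space UNIV"
    using M inp by (simp add: randomized_online_algorithm_def)
  have int: "integrable M (\<lambda>A. real (card (A (run gs))))"
  proof (rule integrable_const_bound)
    show "(\<lambda>A. real (card (A (run gs)))) \<in> borel_measurable M"
      by (rule measurable_compose[OF meas]) simp
    have "card (A (run gs)) \<le> card {..<length (run gs)}" if "A \<in> space M" for A
      using online_algorithm_subset[OF online[OF that] inp] by (intro card_mono) auto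
    then show "AE A in M. norm (real (card (A (run gs)))) \<le> real (length (run gs))"
      by (intro AE_I2) simp
  qed
  have int': "integrable M (\<lambda>A. 1 + (\<Sum>s<n. indicator (caught M gs s) A :: real))"
    using sets by (intro Bochner_Integration.integrable_add Bochner_Integration.integrable_sum
      integrable_real_indicator) (auto simp: emeasure_eq_measure)
  have "expectation (\<lambda>A. real (card (A (run gs)))) \<le>
      expectation (\<lambda>A. 1 + (\<Sum>s<n. indicator (caught M gs s) A))"
  proof (rule integral_mono[OF int int'])
    fix A assume A: "A \<in> space M"
    have "(\<Sum>s<n. indicator (caught M gs s) A :: real)
        = real (card ({..<n} \<inter> {s. A \<in> caught M gs s}))"
      by (simp add: indicator_def sum.If_cases)
    moreover have "{..<n} \<inter> {s. A \<in> caught M gs s}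
        = {s. s < n \<and> good gs s \<in> A (run (take (Suc s) gs))}"
      using A by (auto simp: caught_def)
    ultimately show "real (card (A (run gs))) \<le> 1 + (\<Sum>s<n. indicator (caught M gs s) A)"
      using card_algorithm_le[OF online[OF A] gs] by simp
  qed
  also have "\<dots> = 1 + (\<Sum>s<n. prob (caught M gs s))"
    using sets by (simp add: emeasure_eq_measure prob_space)
  also have "\<dots> \<le> 1 + (\<Sum>s<n. 1 / real n)"
    using unlikely by (intro add_left_mono sum_mono) auto
  also have "\<dots> = 2" using n_pos by simp
  finally show ?thesis by (simp add: expected_ALG_def)
qed

lemma competitive_ratio_ge:
  assumes M: "randomized_online_algorithm d M"
  shows "ennreal (1 / 4 * real k) \<le> competitive_ratio d k (\<lambda>S. real (card S)) M"
proof -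
  obtain gs where gs: "length gs = n" "set gs \<subseteq> {..<n}"
    "\<And>s. s < n \<Longrightarrow> measure M (caught M gs s) \<le> 1 / real n"
    using exists_unlikely_path[OF M order_refl] by auto
  let ?f = "\<lambda>S::nat set. real (card S)"
  \<comment> \<open>The ratio on this input is at least \<open>n / 2\<close>, and \<open>n\<close>
    is at least \<open>k / 2\<close>; this gives the constant 1/4.\<close>
  have "1 / 4 * real k \<le> real n / 2" by (simp add: n_def)
  then have "ennreal (1 / 4 * real k) \<le> ennreal (real n / 2)" by (rule ennreal_leI)
  also have "\<dots> = ennreal (real n) / ennreal 2" by (rule divide_ennreal[symmetric]) auto
  also have "\<dots> \<le> ennreal (OPT d ?f (run gs)) / ennreal (expected_ALG ?f M (run gs))"
    using OPT_run_ge[OF gs(1,2)] expected_ALG_le_2[OF M gs]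
    by (intro divide_ennreal_mono ennreal_leI) auto
  also have "\<dots> \<le> competitive_ratio d k ?f M"
    unfolding competitive_ratio_def using gs n_pos
    by (intro SUP_upper) (auto simp: run_in_inputs sparsity_run)
  finally show ?thesis .
qed

end

theorem theorem1p3:
  "\<exists>c::real. c > 0 \<and>
     (\<forall>(k::nat) (d::nat) (M :: det_algorithm measure).
        k \<le> d \<longrightarrow> randomized_online_algorithm d M \<longrightarrow>
        competitive_ratio d k (\<lambda>S. real (card S)) M \<ge> ennreal (c * real k))"
proof (intro exI[of _ "1 / 4"] conjI allI impI)
  fix k d :: nat and M :: "det_algorithm measure"
  assume kd: "k \<le> d" and M: "randomized_online_algorithm d M"
  show "ennreal (1 / 4 * real k) \<le> competitive_ratio d k (\<lambda>S. real (card S)) M"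
  proof (cases "k = 0")
    case False
    then interpret hard_instance k d using kd by unfold_locales auto
    show ?thesis using M by (rule competitive_ratio_ge)
  qed simp
qed simp

end
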